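(* Let $G=(\mathcal{X},d,P_X)$ be a finite metric probability space. Then for all $\tau>0$, $\breve\varphi_X(\tau)=r(\tau)$, where $\varphi_X(\tau)=\inf\{D(Q_X\|P_X):Q_X\in\mathcal{P}(\mathcal{X}),\mathsf{C}(P_X,Q_X)>\tau\}$, $\breve\varphi_X$ is its lower convex envelope, and $$r(\tau):=\sup_{\lambda\ge0}\ \lambda\tau-L_G(\lambda),$$ with $L_G(\lambda)$ the maximum of $\log P_X(e^{\lambda f})$ over all $1$-Lipschitz functions $f:\mathcal{X}\to\mathbb{R}$ with $P_X(f)=0$.
   Context: A finite metric probability space is a finite set $\mathcal{X}$ with a metric $d$ and a probability measure $P_X$ on $\mathcal{X}$. $\mathcal{P}(\mathcal{X})$ is the set of probability measures on $\mathcal{X}$; $P(f):=\int f\,dP$. $f$ is $1$-Lipschitz if $|f(x)-f(x')|\le d(x,x')$ for all $x,x'$. The cost is $c=d$: $\mathsf{C}(P_X,Q_X):=\min\mathbb{E}[d(X,X')]$ over all couplings $(X,X')$ of $(P_X,Q_X)$. $D(Q\|P):=\int\log\frac{dQ}{dP}\,dQ$ if $Q\ll P$, $+\infty$ otherwise. $\log$ is natural; $\inf\emptyset=+\infty$. The lower convex envelope $\breve g$ of a function $g$ on $[0,\infty)$ is its largest convex minorant.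
   Formalization: The lower convex envelope is taken as the pointwise supremum of real-valued convex minorants; if minorants may equal +∞, the equality fails at the largest finite-entropy transport cost (uniform two-point space with d=1, τ=1/2: envelope +∞, r=log 2). The two envelopes agree at all other τ. *)

theory Defs
  imports "HOL-Probability.Probability"
begin

text \<open>
  A finite metric probability space is given by a finite set \<open>X\<close> with \<^term>\<open>Metric_space X d\<close> and
  a \<open>pmf\<close> whose support lies in \<open>X\<close> (full support is not required).
\<close>

definition finite_metric_prob_space :: "'a set \<Rightarrow> ('a \<Rightarrow> 'a \<Rightarrow> real) \<Rightarrow> 'a pmf \<Rightarrow> bool" where
  "finite_metric_prob_space X d P \<longleftrightarrow> finite X \<and> Metric_space X d \<and> set_pmf P \<subseteq> X"

definition couplings :: "'a pmf \<Rightarrow> 'a pmf \<Rightarrow> ('a \<times> 'a) pmf set" where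
  "couplings P Q = {\<pi>. map_pmf fst \<pi> = P \<and> map_pmf snd \<pi> = Q}"

text \<open>The infimum is a minimum on a finite space; see \<open>transport_cost_attained\<close> below.\<close>

definition transport_cost :: "('a \<Rightarrow> 'a \<Rightarrow> real) \<Rightarrow> 'a pmf \<Rightarrow> 'a pmf \<Rightarrow> real" where
  "transport_cost d P Q =
     (INF \<pi>\<in>couplings P Q. measure_pmf.expectation \<pi> (\<lambda>(x, x'). d x x'))"

text \<open>
  \<open>relative_entropy Q P\<close> is \<open>D(Q\<parallel>P)\<close>; \<^const>\<open>KL_divergence\<close> and \<^const>\<open>absolutely_continuous\<close> take the
  reference measure first.
\<close>

definition relative_entropy :: "'a pmf \<Rightarrow> 'a pmf \<Rightarrow> ereal" where
  "relative_entropy Q P =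
     (if absolutely_continuous (measure_pmf P) (measure_pmf Q)
      then ereal (KL_divergence (exp 1) (measure_pmf P) (measure_pmf Q)) else \<infinity>)"

definition phi :: "'a set \<Rightarrow> ('a \<Rightarrow> 'a \<Rightarrow> real) \<Rightarrow> 'a pmf \<Rightarrow> real \<Rightarrow> ereal" where
  "phi X d P \<tau> =
     (INF Q\<in>{Q. set_pmf Q \<subseteq> X \<and> transport_cost d P Q > \<tau>}. relative_entropy Q P)"

text \<open>
  Minorants range over real-valued convex functions on \<open>[0,\<infinity>)\<close>, and their pointwise supremum is
  taken in \<^typ>\<open>ereal\<close>. Allowing minorants with value \<open>\<infinity>\<close> would change the envelope at the
  boundary of the domain of \<open>g\<close>: \<^term>\<open>phi X d P\<close> is infinite at the largest transport cost \<open>t\<close> from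
  \<open>P\<close> to a measure absolutely continuous with respect to \<open>P\<close>, but bounded on \<open>[0,t)\<close>.
\<close>

definition lower_convex_envelope :: "(real \<Rightarrow> ereal) \<Rightarrow> real \<Rightarrow> ereal" where
  "lower_convex_envelope g t =
     (SUP h\<in>{h. convex_on {0..} h \<and> (\<forall>s\<ge>0. ereal (h s) \<le> g s)}. ereal (h t))"

definition centered_lipschitz ::
    "'a set \<Rightarrow> ('a \<Rightarrow> 'a \<Rightarrow> real) \<Rightarrow> 'a pmf \<Rightarrow> ('a \<Rightarrow> real) set" where
  "centered_lipschitz X d P =
     {f. (\<forall>x\<in>X. \<forall>x'\<in>X. \<bar>f x - f x'\<bar> \<le> d x x') \<and> measure_pmf.expectation P f = 0}"

text \<open>The supremum is a maximum on a finite space; see \<open>log_laplace_attained\<close> below.\<close>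

definition log_laplace :: "'a set \<Rightarrow> ('a \<Rightarrow> 'a \<Rightarrow> real) \<Rightarrow> 'a pmf \<Rightarrow> real \<Rightarrow> real" where
  "log_laplace X d P l =
     (SUP f\<in>centered_lipschitz X d P. ln (measure_pmf.expectation P (\<lambda>x. exp (l * f x))))"

definition rate :: "'a set \<Rightarrow> ('a \<Rightarrow> 'a \<Rightarrow> real) \<Rightarrow> 'a pmf \<Rightarrow> real \<Rightarrow> ereal" where
  "rate X d P \<tau> = (SUP l\<in>{0..}. ereal (l * \<tau> - log_laplace X d P l))"

lemma expectation_finite_support:
  fixes f :: "'a \<Rightarrow> real"
  assumes "finite X" "set_pmf P \<subseteq> X"
  shows "measure_pmf.expectation P f = (\<Sum>x\<in>X. f x * pmf P x)"
  using assms by (intro integral_measure_pmf_real) auto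

lemma compact_PiE_UNIV:
  fixes S :: "'a \<Rightarrow> real set"
  assumes "\<And>x. compact (S x)"
  shows "compact (PiE UNIV S)"
proof -
  have "compactin (product_topology (\<lambda>_. euclidean) UNIV) (PiE UNIV S)"
    using assms by (simp add: compactin_PiE)
  then show ?thesis
    by (simp add: euclidean_product_topology)
qed

lemma log_laplace_attained:
  assumes G: "finite_metric_prob_space X d P"
  shows "\<exists>f\<in>centered_lipschitz X d P.
           log_laplace X d P l = ln (measure_pmf.expectation P (\<lambda>x. exp (l * f x))) \<and>
           (\<forall>g\<in>centered_lipschitz X d P. ln (measure_pmf.expectation P (\<lambda>x. exp (l * g x)))
              \<le> ln (measure_pmf.expectation P (\<lambda>x. exp (l * f x))))"
proof -
  have fin: "finite X" and sub: "set_pmf P \<subseteq> X" and "Metric_space X d"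
    using G by (auto simp: finite_metric_prob_space_def)
  interpret Metric_space X d by fact
  note E = expectation_finite_support[OF fin sub]
  have sum1: "(\<Sum>x\<in>X. pmf P x) = 1"
    using fin sub by (rule sum_pmf_eq_1)
  define B where "B = (\<Sum>x\<in>X. \<Sum>y\<in>X. d x y)"
  have dB: "d x y \<le> B" if "x \<in> X" "y \<in> X" for x y
  proof -
    have "d x y \<le> (\<Sum>y\<in>X. d x y)"
      using that fin by (intro member_le_sum) auto
    also have "\<dots> \<le> B"
      unfolding B_def using that fin
      by (intro member_le_sum[where f = "\<lambda>x. \<Sum>y\<in>X. d x y"]) (auto intro: sum_nonneg)
    finally show ?thesis .
  qed
  define S where "S x = (if x \<in> X then {-B..B} else {0})" for x
  define F where "F f = (\<Sum>x\<in>X. exp (l * f x) * pmf P x)" for f :: "'a \<Rightarrow> real"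
  define K where "K = PiE UNIV S \<inter> ((\<Inter>x\<in>X. \<Inter>y\<in>X. {f. \<bar>f x - f y\<bar> \<le> d x y})
                        \<inter> {f. (\<Sum>x\<in>X. f x * pmf P x) = 0})"
  have cont: "continuous_on UNIV (\<lambda>f :: 'a \<Rightarrow> real. f x)" for x
    by simp
  have "closed {f :: 'a \<Rightarrow> real. \<bar>f x - f y\<bar> \<le> d x y}" for x y
    by (intro closed_Collect_le continuous_intros cont)
  moreover have "closed {f :: 'a \<Rightarrow> real. (\<Sum>x\<in>X. f x * pmf P x) = 0}"
    by (intro closed_Collect_eq continuous_intros cont)
  moreover have "compact (PiE UNIV S)"
    by (rule compact_PiE_UNIV) (simp add: S_def)
  ultimately have "compact K"
    unfolding K_def by (intro compact_Int_closed closed_Int closed_INT ballI)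
  moreover have "0 \<le> B"
    unfolding B_def by (intro sum_nonneg) auto
  then have "(\<lambda>_. 0) \<in> K"
    by (auto simp: K_def S_def)
  then have "K \<noteq> {}" by blast
  moreover have "continuous_on K F"
    unfolding F_def by (intro continuous_intros continuous_on_subset[OF cont]) auto
  ultimately obtain f where f: "f \<in> K" "\<And>g. g \<in> K \<Longrightarrow> F g \<le> F f"
    using continuous_attains_sup[of K F] by blast
  have fL: "f \<in> centered_lipschitz X d P"
    using f(1) by (auto simp: K_def centered_lipschitz_def E)
  have Fpos: "0 < F g" for g
  proof -
    have "0 < pmf P x" if "x \<in> set_pmf P" for x
      using that by (simp add: pmf_positive)
    moreover obtain x where "x \<in> set_pmf P"
      using set_pmf_not_empty by fast
    ultimately show ?thesis
      unfolding F_def using fin sub by (intro sum_pos2[of X x]) auto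
  qed
  have max: "ln (F g) \<le> ln (F f)" if g: "g \<in> centered_lipschitz X d P" for g
  proof -
    define g' where "g' x = (if x \<in> X then g x else 0)" for x
    have lip: "\<bar>g x - g y\<bar> \<le> d x y" if "x \<in> X" "y \<in> X" for x y
      using g that by (auto simp: centered_lipschitz_def)
    have mean: "(\<Sum>x\<in>X. g x * pmf P x) = 0"
      using g by (simp add: centered_lipschitz_def E)
    have "\<bar>g x\<bar> \<le> B" if "x \<in> X" for x
    proof -
      have "g x = (\<Sum>y\<in>X. (g x - g y) * pmf P y)"
        using sum1 mean
        by (simp add: left_diff_distrib sum_subtractf flip: sum_distrib_left)
      also have "\<bar>\<dots>\<bar> \<le> (\<Sum>y\<in>X. \<bar>(g x - g y) * pmf P y\<bar>)"
        by (rule sum_abs)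
      also have "\<dots> \<le> (\<Sum>y\<in>X. B * pmf P y)"
        using order_trans[OF lip dB] that
        by (intro sum_mono) (auto simp: abs_mult intro!: mult_right_mono)
      also have "\<dots> = B"
        using sum1 by (simp flip: sum_distrib_left)
      finally show ?thesis .
    qed
    then have "g' \<in> K"
      using lip mean by (auto simp: K_def S_def g'_def abs_le_iff minus_le_iff)
    then have "F g' \<le> F f" by (rule f(2))
    moreover have "F g' = F g"
      unfolding F_def g'_def by (intro sum.cong) auto
    ultimately show ?thesis
      using Fpos by simp
  qed
  have "log_laplace X d P l = ln (F f)"
    unfolding log_laplace_def E F_def[symmetric]
    using fL max by (intro cSup_eq_maximum) auto
  then show ?thesis
    using fL max by (auto simp: E F_def)
qed

lemma transport_cost_attained:
  assumes G: "finite_metric_prob_space X d P" and Q: "set_pmf Q \<subseteq> X"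
  shows "\<exists>\<pi>\<in>couplings P Q.
           transport_cost d P Q = measure_pmf.expectation \<pi> (\<lambda>(x, x'). d x x') \<and>
           (\<forall>\<rho>\<in>couplings P Q. measure_pmf.expectation \<pi> (\<lambda>(x, x'). d x x')
              \<le> measure_pmf.expectation \<rho> (\<lambda>(x, x'). d x x'))"
proof -
  have fin: "finite X" and sub: "set_pmf P \<subseteq> X"
    using G by (auto simp: finite_metric_prob_space_def)
  have finXX: "finite (X \<times> X)" using fin by simp
  define F where "F q = (\<Sum>z\<in>X \<times> X. (case z of (x, x') \<Rightarrow> d x x') * q z)"
    for q :: "'a \<times> 'a \<Rightarrow> real"
  define S where "S z = (if z \<in> X \<times> X then {0..1} else {0::real})" for z
  define K where "K = PiE UNIV S \<inter> ((\<Inter>x\<in>X. {q. (\<Sum>y\<in>X. q (x, y)) = pmf P x})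
                        \<inter> (\<Inter>y\<in>X. {q. (\<Sum>x\<in>X. q (x, y)) = pmf Q y}))"
  have cont: "continuous_on UNIV (\<lambda>q :: 'a \<times> 'a \<Rightarrow> real. q z)" for z
    by simp
  have "closed {q :: 'a \<times> 'a \<Rightarrow> real. (\<Sum>y\<in>X. q (x, y)) = pmf P x}" for x
    by (intro closed_Collect_eq continuous_intros cont)
  moreover have "closed {q :: 'a \<times> 'a \<Rightarrow> real. (\<Sum>x\<in>X. q (x, y)) = pmf Q y}" for y
    by (intro closed_Collect_eq continuous_intros cont)
  moreover have "compact (PiE UNIV S)"
    by (rule compact_PiE_UNIV) (simp add: S_def)
  ultimately have cK: "compact K"
    unfolding K_def by (intro compact_Int_closed closed_Int closed_INT ballI)
  have supp: "set_pmf \<rho> \<subseteq> X \<times> X" if "\<rho> \<in> couplings P Q" for \<rho>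
  proof -
    have "fst ` set_pmf \<rho> = set_pmf P" "snd ` set_pmf \<rho> = set_pmf Q"
      using that unfolding couplings_def by (metis (mono_tags, lifting) mem_Collect_eq set_map_pmf)+
    then show ?thesis
      using sub Q by (force simp: image_subset_iff)
  qed
  have marg1: "pmf (map_pmf fst \<rho>) x = (\<Sum>y\<in>X. pmf \<rho> (x, y))"
    if "set_pmf \<rho> \<subseteq> X \<times> X" for \<rho> :: "('a \<times> 'a) pmf" and x
  proof -
    have "pmf (map_pmf fst \<rho>) x = measure_pmf.prob \<rho> (fst -` {x})"
      by (simp add: pmf_map)
    also have "\<dots> = measure_pmf.prob \<rho> (Pair x ` X)"
      using that by (intro measure_eq_AE) (auto simp: AE_measure_pmf_iff)
    also have "\<dots> = (\<Sum>y\<in>X. pmf \<rho> (x, y))"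
      using fin by (simp add: measure_measure_pmf_finite sum.reindex inj_on_def)
    finally show ?thesis .
  qed
  have marg2: "pmf (map_pmf snd \<rho>) y = (\<Sum>x\<in>X. pmf \<rho> (x, y))"
    if "set_pmf \<rho> \<subseteq> X \<times> X" for \<rho> :: "('a \<times> 'a) pmf" and y
  proof -
    have "pmf (map_pmf snd \<rho>) y = measure_pmf.prob \<rho> (snd -` {y})"
      by (simp add: pmf_map)
    also have "\<dots> = measure_pmf.prob \<rho> ((\<lambda>x. (x, y)) ` X)"
      using that by (intro measure_eq_AE) (auto simp: AE_measure_pmf_iff)
    also have "\<dots> = (\<Sum>x\<in>X. pmf \<rho> (x, y))"
      using fin by (simp add: measure_measure_pmf_finite sum.reindex inj_on_def)
    finally show ?thesis .
  qed
  have E: "measure_pmf.expectation \<rho> (\<lambda>(x, x'). d x x') = F (pmf \<rho>)"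
    if "\<rho> \<in> couplings P Q" for \<rho>
    unfolding F_def by (rule expectation_finite_support[OF finXX supp[OF that]])
  have toK: "pmf \<rho> \<in> K" if "\<rho> \<in> couplings P Q" for \<rho>
  proof -
    have "pmf \<rho> z = 0" if "z \<notin> X \<times> X" for z
      using supp[OF \<open>\<rho> \<in> couplings P Q\<close>] that by (auto simp: set_pmf_iff)
    moreover have "(\<Sum>y\<in>X. pmf \<rho> (x, y)) = pmf P x" "(\<Sum>x\<in>X. pmf \<rho> (x, y)) = pmf Q y" for x y
      using marg1[OF supp[OF that], of x] marg2[OF supp[OF that], of y] that
      by (auto simp: couplings_def)
    ultimately show ?thesis
      by (auto simp: K_def S_def pmf_le_1)
  qed
  have "pair_pmf P Q \<in> couplings P Q"
    by (simp add: couplings_def map_fst_pair_pmf map_snd_pair_pmf)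
  with toK have "K \<noteq> {}" by blast
  moreover have "continuous_on K F"
    unfolding F_def by (intro continuous_intros continuous_on_subset[OF cont]) auto
  ultimately obtain q where q: "q \<in> K" "\<And>q'. q' \<in> K \<Longrightarrow> F q \<le> F q'"
    using continuous_attains_inf[of K F] cK by blast
  have qS: "q z \<in> S z" for z
    using q(1) unfolding K_def by blast
  have q0: "q z = 0" if "z \<notin> X \<times> X" for z
    using qS[of z] that unfolding S_def by (simp split: if_splits)
  have qnn: "0 \<le> q z" for z
    using qS[of z] unfolding S_def by (simp split: if_splits)
  have "(\<Sum>z\<in>X \<times> X. q z) = (\<Sum>x\<in>X. \<Sum>y\<in>X. q (x, y))"
    by (simp add: sum.cartesian_product)
  also have "\<dots> = (\<Sum>x\<in>X. pmf P x)"
    using q(1) by (intro sum.cong) (auto simp: K_def)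
  finally have qsum: "(\<Sum>z\<in>X \<times> X. q z) = 1"
    using sum_pmf_eq_1[OF fin sub] by simp
  have "(\<integral>\<^sup>+z. ennreal (q z) \<partial>count_space UNIV) = (\<Sum>z\<in>X \<times> X. ennreal (q z))"
    using q0 by (intro nn_integral_count_space'[OF finXX]) auto
  also have "\<dots> = ennreal (\<Sum>z\<in>X \<times> X. q z)"
    using qnn by (intro sum_ennreal) auto
  finally have tot: "(\<integral>\<^sup>+z. ennreal (q z) \<partial>count_space UNIV) = 1"
    using qsum by simp
  define \<pi> where "\<pi> = embed_pmf q"
  have pq: "pmf \<pi> = q"
    unfolding \<pi>_def using qnn tot by (auto intro!: pmf_embed_pmf)
  have sp: "set_pmf \<pi> \<subseteq> X \<times> X"
    using q0 by (auto simp: set_pmf_eq pq)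
  have "pmf (map_pmf fst \<pi>) x = pmf P x" for x
  proof (cases "x \<in> X")
    case True
    then show ?thesis using marg1[OF sp] q(1) by (auto simp: pq K_def)
  next
    case False
    then have "x \<notin> set_pmf P" using sub by auto
    with False show ?thesis using marg1[OF sp] q0 by (auto simp: pq set_pmf_iff)
  qed
  moreover have "pmf (map_pmf snd \<pi>) y = pmf Q y" for y
  proof (cases "y \<in> X")
    case True
    then show ?thesis using marg2[OF sp] q(1) by (auto simp: pq K_def)
  next
    case False
    then have "y \<notin> set_pmf Q" using Q by auto
    with False show ?thesis using marg2[OF sp] q0 by (auto simp: pq set_pmf_iff)
  qed
  ultimately have pi: "\<pi> \<in> couplings P Q"
    by (auto simp: couplings_def intro: pmf_eqI)
  have min: "measure_pmf.expectation \<pi> (\<lambda>(x, x'). d x x')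
               \<le> measure_pmf.expectation \<rho> (\<lambda>(x, x'). d x x')"
    if "\<rho> \<in> couplings P Q" for \<rho>
    using E[OF pi] E[OF that] q(2)[OF toK[OF that]] by (simp add: pq)
  have "transport_cost d P Q = measure_pmf.expectation \<pi> (\<lambda>(x, x'). d x x')"
    unfolding transport_cost_def using pi min by (intro cInf_eq_minimum) auto
  then show ?thesis
    using pi min by blast
qed

end

theory Submission
  imports Defs
begin

text \<open>
  By Kantorovich duality and the Donsker--Varadhan inequality, every line \<open>s \<mapsto> l * s - L l\<close>
  with \<open>l \<ge> 0\<close> and \<open>L\<close> the maximal log-Laplace transform lies below \<open>phi\<close>, so the rate is below the
  envelope. Conversely, a convex minorant has a supporting line of slope \<open>a\<close> at \<open>\<tau>\<close>. If \<open>a > 0\<close>, testing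
  the line on the measures tilted by \<open>exp (a * f)\<close>, for which Donsker--Varadhan is an equality, bounds its
  intercept by \<open>- L a\<close>. If \<open>a \<le> 0\<close>, the minorant at \<open>\<tau>\<close> is at most its value at \<open>0\<close>, and \<open>phi\<close> vanishes
  there because small tilts have arbitrarily small entropy. If all centered Lipschitz functions vanish
  on the support of \<open>P\<close>, the rate is infinite.
\<close>

section \<open>Finitely supported probability mass functions\<close>

lemma obtain_pmf:
  fixes q :: "'b \<Rightarrow> real"
  assumes "finite A" "\<And>z. 0 \<le> q z" "\<And>z. z \<notin> A \<Longrightarrow> q z = 0" "sum q A = 1"
  obtains p where "pmf p = q" "set_pmf p \<subseteq> A"
proof -
  have "(\<integral>\<^sup>+z. ennreal (q z) \<partial>count_space UNIV) = (\<Sum>z\<in>A. ennreal (q z))"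
    using assms by (intro nn_integral_count_space') auto
  also have "\<dots> = ennreal (sum q A)"
    using assms by (intro sum_ennreal) auto
  finally have "(\<integral>\<^sup>+z. ennreal (q z) \<partial>count_space UNIV) = 1"
    using assms by simp
  with assms have eq: "pmf (embed_pmf q) = q"
    by (intro ext pmf_embed_pmf) auto
  moreover have "set_pmf (embed_pmf q) \<subseteq> A"
    using assms(3) by (auto simp: set_pmf_eq eq)
  ultimately show thesis by (rule that)
qed

text \<open>Marginals of couplings can thus be compared by testing indicator costs that depend on
  one coordinate only.\<close>

lemma pmf_map_expectation:
  "pmf (map_pmf f p) x = measure_pmf.expectation p (\<lambda>z. of_bool (f z = x))"
proof -
  have "pmf (map_pmf f p) x = measure_pmf.expectation p (indicat_real (f -` {x}))"
    by (simp add: pmf_map)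
  also have "indicat_real (f -` {x}) = (\<lambda>z. of_bool (f z = x))"
    by (auto simp: indicator_def)
  finally show ?thesis .
qed

lemma expectation_exp_pos:
  fixes f :: "'a \<Rightarrow> real"
  assumes "finite X" "set_pmf P \<subseteq> X"
  shows "0 < measure_pmf.expectation P (\<lambda>x. exp (f x))"
proof -
  obtain x where "x \<in> set_pmf P"
    using set_pmf_not_empty by fast
  with assms show ?thesis
    by (auto simp: expectation_finite_support[OF assms] pmf_positive intro!: sum_pos2[of X x])
qed

section \<open>Kantorovich duality\<close>

text \<open>
  The cost of rerouting the pairs of the chain, each target being served by the source of its
  predecessor (the first by \<open>u\<close>). For an optimal coupling, the infimum over chains in its support
  is minus a Kantorovich potential at \<open>u\<close>.
\<close>

fun chain_cost :: "('a \<Rightarrow> 'a \<Rightarrow> real) \<Rightarrow> 'a \<Rightarrow> ('a \<times> 'a) list \<Rightarrow> real" where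
  "chain_cost c u [] = 0"
| "chain_cost c u ((x, y) # zs) = c u y - c x y + chain_cost c x zs"

text \<open>The chain cost is linear in the cost function, and indicator costs form a basis on
  \<open>X \<times> X\<close>. The coefficient of \<open>z\<close> is the net mass that unit
  rerouting adds at \<open>z\<close>; it later perturbs an optimal coupling.\<close>

lemma chain_cost_expand:
  assumes "finite X" "u \<in> X" "set zs \<subseteq> X \<times> X"
  shows "chain_cost c u zs
    = (\<Sum>z\<in>X \<times> X. (case z of (x, y) \<Rightarrow> c x y) * chain_cost (\<lambda>a b. of_bool ((a, b) = z)) u zs)"
  using assms(2,3)
proof (induction zs arbitrary: u)
  case Nil
  then show ?case by simp
next
  case (Cons z zs)
  obtain x y where z: "z = (x, y)" by fastforce
  have pick: "(\<Sum>w\<in>X \<times> X. (case w of (x, y) \<Rightarrow> c x y) * of_bool ((a, b) = w)) = c a b"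
    if "a \<in> X" "b \<in> X" for a b
    using assms(1) that by (subst sum.remove[of _ "(a, b)"]) (auto intro!: sum.neutral)
  have "x \<in> X" "y \<in> X" "u \<in> X" "set zs \<subseteq> X \<times> X"
    using Cons.prems by (auto simp: z)
  then show ?case
    using Cons.IH[of x]
    by (simp add: z distrib_left right_diff_distrib sum.distrib sum_subtractf pick)
qed

text \<open>Rerouting never changes targets, so every link contributes zero. This preserves the
  second marginal and, for constant \<open>h\<close>, the total mass.\<close>

lemma chain_cost_snd: "chain_cost (\<lambda>a b. h b) u zs = 0"
  by (induction zs arbitrary: u) auto

text \<open>The sum telescopes. It vanishes for a chain closed by \<open>u = fst (last zs)\<close>,
  which preserves the first marginal.\<close>

lemma chain_cost_fst: "zs \<noteq> [] \<Longrightarrow> chain_cost (\<lambda>a b. h a) u zs = h u - h (fst (last zs))"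
proof (induction zs arbitrary: u)
  case (Cons z zs)
  then show ?case by (cases z; cases "zs = []") auto
qed simp

text \<open>Each link subtracts at most one indicator, so at most one unit of mass at
  \<open>z\<close>.\<close>

lemma chain_cost_delta_ge: "- real (length zs) \<le> chain_cost (\<lambda>a b. of_bool ((a, b) = z)) u zs"
proof (induction zs arbitrary: u)
  case (Cons w zs)
  obtain x y where w: "w = (x, y)" by fastforce
  show ?case using Cons.IH[of x] by (auto simp: w of_bool_def)
qed simp

lemma chain_cost_delta_nonneg:
  "z \<notin> set zs \<Longrightarrow> 0 \<le> chain_cost (\<lambda>a b. of_bool ((a, b) = z)) u zs"
proof (induction zs arbitrary: u)
  case (Cons w zs)
  obtain x y where w: "w = (x, y)" by fastforce
  show ?case using Cons.IH[of x] Cons.prems by (auto simp: w of_bool_def)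
qed simp

lemma chain_cost_delta_outside:
  "z \<notin> X \<times> X \<Longrightarrow> u \<in> X \<Longrightarrow> set zs \<subseteq> X \<times> X \<Longrightarrow> chain_cost (\<lambda>a b. of_bool ((a, b) = z)) u zs = 0"
proof (induction zs arbitrary: u)
  case (Cons w zs)
  obtain x y where w: "w = (x, y)" by fastforce
  show ?case using Cons.IH[of x] Cons.prems by (auto simp: w of_bool_def)
qed simp

lemma couplings_support:
  assumes "\<pi> \<in> couplings P Q" "set_pmf P \<subseteq> X" "set_pmf Q \<subseteq> X"
  shows "set_pmf \<pi> \<subseteq> X \<times> X"
proof -
  have "fst ` set_pmf \<pi> = set_pmf P" "snd ` set_pmf \<pi> = set_pmf Q"
    using assms(1) unfolding couplings_def by (metis (mono_tags, lifting) mem_Collect_eq set_map_pmf)+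
  then show ?thesis
    using assms(2,3) by (force simp: image_subset_iff)
qed

text \<open>
  Moving mass \<open>e\<close> around a closed chain of support points keeps the marginals and changes
  the cost by \<open>e\<close> times the chain cost.
\<close>

lemma optimal_coupling_cyclically_monotone:
  assumes fin: "finite X" and P: "set_pmf P \<subseteq> X" and Q: "set_pmf Q \<subseteq> X"
    and pi: "\<pi> \<in> couplings P Q"
    and opt: "\<And>\<rho>. \<rho> \<in> couplings P Q \<Longrightarrow> measure_pmf.expectation \<pi> (\<lambda>(x, x'). c x x')
                \<le> measure_pmf.expectation \<rho> (\<lambda>(x, x'). c x x')"
    and ne: "zs \<noteq> []" and zs: "set zs \<subseteq> set_pmf \<pi>"
  shows "0 \<le> chain_cost c (fst (last zs)) zs"
proof -
  define u where "u = fst (last zs)"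
  define A where "A z = chain_cost (\<lambda>a b. of_bool ((a, b) = z)) u zs" for z
  define m where "m = Min (pmf \<pi> ` set zs)"
  \<comment> \<open>Even a pair used by every link loses at most \<open>e * length zs = m\<close>,
    and no pair of the chain has mass below \<open>m\<close>.\<close>
  define e where "e = m / length zs"
  define q where "q z = pmf \<pi> z + e * A z" for z
  have sup: "set_pmf \<pi> \<subseteq> X \<times> X"
    using couplings_support[OF pi P Q] .
  have finXX: "finite (X \<times> X)" using fin by simp
  have zsX: "set zs \<subseteq> X \<times> X" using zs sup by simp
  have "last zs \<in> X \<times> X" using ne zsX by (meson last_in_set subsetD)
  then have uX: "u \<in> X" by (auto simp: u_def)
  have "m \<in> pmf \<pi> ` set zs"
    unfolding m_def using ne by (intro Min_in) auto
  then have m: "0 < m" using zs by (auto simp: pmf_positive)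
  then have e: "0 < e" using ne by (simp add: e_def)
  have q0: "0 \<le> q z" for z
  proof (cases "z \<in> set zs")
    case True
    have "m \<le> pmf \<pi> z"
      unfolding m_def using True by (intro Min_le) auto
    moreover have "e * - real (length zs) \<le> e * A z"
      unfolding A_def using e by (intro mult_left_mono chain_cost_delta_ge) auto
    ultimately show ?thesis
      using ne by (simp add: q_def e_def)
  next
    case False
    then show ?thesis
      unfolding q_def A_def using e by (simp add: chain_cost_delta_nonneg)
  qed
  have qout: "q z = 0" if "z \<notin> X \<times> X" for z
  proof -
    have "z \<notin> set_pmf \<pi>" using sup that by blast
    then show ?thesis
      unfolding q_def A_def using chain_cost_delta_outside[OF that uX zsX] by (simp add: set_pmf_iff)
  qed
  \<comment> \<open>One identity for all costs \<open>g\<close>: constants give the total mass,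
    functions of one coordinate the marginals, and \<open>c\<close> the change in transport
    cost.\<close>
  have qE: "(\<Sum>z\<in>X \<times> X. (case z of (x, y) \<Rightarrow> g x y) * q z)
      = measure_pmf.expectation \<pi> (\<lambda>(x, y). g x y) + e * chain_cost g u zs" for g
    unfolding chain_cost_expand[OF fin uX zsX, of g] expectation_finite_support[OF finXX sup] q_def A_def
    by (simp add: distrib_left sum.distrib sum_distrib_left mult_ac)
  have "sum q (X \<times> X) = 1"
    using qE[of "\<lambda>_ _. 1"] chain_cost_snd[of "\<lambda>_. 1" u zs] by (simp add: case_prod_unfold)
  with q0 qout finXX obtain \<rho> where rho: "pmf \<rho> = q" "set_pmf \<rho> \<subseteq> X \<times> X"
    using obtain_pmf by metis
  have E: "measure_pmf.expectation \<rho> (\<lambda>(x, y). g x y)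
      = measure_pmf.expectation \<pi> (\<lambda>(x, y). g x y) + e * chain_cost g u zs" for g
    using qE by (simp add: expectation_finite_support[OF finXX rho(2)] rho(1))
  have "map_pmf fst \<rho> = map_pmf fst \<pi>"
    using E[of "\<lambda>a b. of_bool (a = x)" for x] chain_cost_fst[OF ne, of "\<lambda>a. of_bool (a = x)" u for x]
    by (intro pmf_eqI) (simp add: pmf_map_expectation u_def case_prod_unfold)
  moreover have "map_pmf snd \<rho> = map_pmf snd \<pi>"
    using E[of "\<lambda>a b. of_bool (b = x)" for x] chain_cost_snd[of "\<lambda>a. of_bool (a = x)" u zs for x]
    by (intro pmf_eqI) (simp add: pmf_map_expectation case_prod_unfold)
  ultimately have "\<rho> \<in> couplings P Q"
    using pi by (simp add: couplings_def)
  from opt[OF this] e show ?thesis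
    by (simp add: E u_def zero_le_mult_iff)
qed

section \<open>Lipschitz functions and optimal couplings\<close>

lemma coupling_difference:
  fixes f :: "'a \<Rightarrow> real"
  assumes fin: "finite X" and P: "set_pmf P \<subseteq> X" and Q: "set_pmf Q \<subseteq> X"
    and pi: "\<pi> \<in> couplings P Q"
  shows "measure_pmf.expectation Q f - measure_pmf.expectation P f
    = measure_pmf.expectation \<pi> (\<lambda>(x, y). f y - f x)"
proof -
  have sup: "set_pmf \<pi> \<subseteq> X \<times> X"
    using couplings_support[OF pi P Q] .
  have finXX: "finite (X \<times> X)" using fin by simp
  have "measure_pmf.expectation Q f = measure_pmf.expectation \<pi> (\<lambda>z. f (snd z))"
    "measure_pmf.expectation P f = measure_pmf.expectation \<pi> (\<lambda>z. f (fst z))"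
    using pi by (auto simp: couplings_def simp flip: integral_map_pmf)
  then show ?thesis
    by (simp add: expectation_finite_support[OF finXX sup] case_prod_unfold
        left_diff_distrib sum_subtractf)
qed

text \<open>The easy half of duality: integrate \<open>f y - f x \<le> d x y\<close> against an
  optimal coupling.\<close>

lemma transport_cost_ge_lipschitz:
  assumes G: "finite_metric_prob_space X d P" and Q: "set_pmf Q \<subseteq> X"
    and f: "f \<in> centered_lipschitz X d P"
  shows "measure_pmf.expectation Q f \<le> transport_cost d P Q"
proof -
  have fin: "finite X" and P: "set_pmf P \<subseteq> X"
    using G by (auto simp: finite_metric_prob_space_def)
  obtain \<pi> where pi: "\<pi> \<in> couplings P Q"
    and c: "transport_cost d P Q = measure_pmf.expectation \<pi> (\<lambda>(x, x'). d x x')"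
    using transport_cost_attained[OF G Q] by blast
  have finXX: "finite (X \<times> X)" using fin by simp
  note sup = couplings_support[OF pi P Q]
  have "f y - f x \<le> d x y" if "x \<in> X" "y \<in> X" for x y
    using f that by (force simp: centered_lipschitz_def)
  then have "measure_pmf.expectation \<pi> (\<lambda>(x, y). f y - f x) \<le> measure_pmf.expectation \<pi> (\<lambda>(x, y). d x y)"
    unfolding expectation_finite_support[OF finXX sup]
    by (intro sum_mono mult_right_mono) auto
  then show ?thesis
    using coupling_difference[OF fin P Q pi, of f] f by (simp add: c centered_lipschitz_def)
qed

text \<open>The hard half of duality. Cyclical monotonicity makes the infimum over chains finite;
  the resulting Lipschitz function has increments exactly \<open>d\<close> on the support of an
  optimal coupling, so integration gives equality.\<close>

lemma kantorovich_potential: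
  assumes G: "finite_metric_prob_space X d P" and Q: "set_pmf Q \<subseteq> X"
  obtains f where "f \<in> centered_lipschitz X d P"
    "measure_pmf.expectation Q f = transport_cost d P Q"
proof -
  have fin: "finite X" and P: "set_pmf P \<subseteq> X" and "Metric_space X d"
    using G by (auto simp: finite_metric_prob_space_def)
  interpret Metric_space X d by fact
  obtain \<pi> where pi: "\<pi> \<in> couplings P Q"
    and c: "transport_cost d P Q = measure_pmf.expectation \<pi> (\<lambda>(x, x'). d x x')"
    and opt: "\<And>\<rho>. \<rho> \<in> couplings P Q \<Longrightarrow> measure_pmf.expectation \<pi> (\<lambda>(x, x'). d x x')
              \<le> measure_pmf.expectation \<rho> (\<lambda>(x, x'). d x x')"
    using transport_cost_attained[OF G Q] by blast
  have finXX: "finite (X \<times> X)" using fin by simp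
  note sup = couplings_support[OF pi P Q]
  define C where "C = {zs. set zs \<subseteq> set_pmf \<pi>}"
  define g where "g u = (INF zs\<in>C. chain_cost d u zs)" for u
  define B where "B = Max ((\<lambda>(x, y). d x y) ` (X \<times> X))"
  have dB: "d x y \<le> B" if "x \<in> X" "y \<in> X" for x y
    unfolding B_def using that finXX by (intro Max_ge) force+
  \<comment> \<open>Only the first link depends on the starting point, so one triangle inequality
    suffices.\<close>
  have lip: "chain_cost d u zs \<le> chain_cost d v zs + d u v"
    if "zs \<in> C" "u \<in> X" "v \<in> X" for u v zs
  proof (cases zs)
    case (Cons z zs')
    obtain x y where z: "z = (x, y)" by fastforce
    have "y \<in> X" using that sup by (auto simp: C_def Cons z)
    then show ?thesis
      using triangle[of u v y] that by (simp add: Cons z)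
  qed auto
  \<comment> \<open>Starting at the last source closes the chain and makes its cost nonnegative;
    moving the start to \<open>u\<close> costs at most \<open>B\<close>.\<close>
  have lower: "- B \<le> chain_cost d u zs" if "zs \<in> C" "u \<in> X" for u zs
  proof (cases "zs = []")
    case True
    then show ?thesis using dB[OF that(2) that(2)] that by simp
  next
    case False
    then have "last zs \<in> X \<times> X"
      using that sup unfolding C_def by (metis last_in_set mem_Collect_eq subsetD)
    then have last: "fst (last zs) \<in> X" by auto
    have "0 \<le> chain_cost d (fst (last zs)) zs"
      using optimal_coupling_cyclically_monotone[OF fin P Q pi opt False] that by (simp add: C_def)
    also have "\<dots> \<le> chain_cost d u zs + d (fst (last zs)) u"
      using lip that last by blast
    finally show ?thesis using dB[OF last that(2)] by simp
  qed
  have bdd: "bdd_below ((\<lambda>zs. chain_cost d u zs) ` C)" if "u \<in> X" for u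
    using lower that by (intro bdd_belowI2) blast
  have neC: "C \<noteq> {}" by (auto simp: C_def intro: exI[of _ "[]"])
  have gle: "g u \<le> chain_cost d u zs" if "zs \<in> C" "u \<in> X" for u zs
    unfolding g_def using that bdd by (intro cINF_lower)
  have glip: "g u \<le> g v + d u v" if "u \<in> X" "v \<in> X" for u v
  proof -
    have "g u - d u v \<le> g v"
      unfolding g_def[of v]
    proof (rule cINF_greatest[OF neC])
      fix zs assume "zs \<in> C"
      then show "g u - d u v \<le> chain_cost d v zs"
        using gle[of zs u] lip[of zs u v] that by linarith
    qed
    then show ?thesis by simp
  qed
  \<comment> \<open>Prepending \<open>(x, y)\<close> turns a chain started at \<open>x\<close> into
    one started at \<open>y\<close> that is cheaper by \<open>d x y\<close>, because
    \<open>d y y = 0\<close>. The other inequality is the Lipschitz bound.\<close>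
  have gsupp: "g x - g y = d x y" if "(x, y) \<in> set_pmf \<pi>" for x y
  proof -
    have xy: "x \<in> X" "y \<in> X" using that sup by auto
    have "g y + d x y \<le> g x"
      unfolding g_def[of x]
    proof (rule cINF_greatest[OF neC])
      fix zs assume "zs \<in> C"
      then have "(x, y) # zs \<in> C" using that by (simp add: C_def)
      from gle[OF this xy(2)] xy show "g y + d x y \<le> chain_cost d x zs"
        by simp
    qed
    with glip[OF xy] show ?thesis by simp
  qed
  \<comment> \<open>The sign is reversed because \<open>g\<close> decreases from source to target;
    the constant centers \<open>f\<close>.\<close>
  define f where "f u = measure_pmf.expectation P g - g u" for u
  have "\<bar>f x - f y\<bar> \<le> d x y" if "x \<in> X" "y \<in> X" for x y
    using glip[OF that] glip[OF that(2,1)] commute[of x y] by (simp add: f_def abs_le_iff)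
  moreover have "measure_pmf.expectation P f = 0"
    using sum_pmf_eq_1[OF fin P] unfolding f_def
    by (subst expectation_finite_support[OF fin P])
      (simp add: left_diff_distrib sum_subtractf expectation_finite_support[OF fin P]
        flip: sum_distrib_left)
  ultimately have f: "f \<in> centered_lipschitz X d P"
    by (simp add: centered_lipschitz_def)
  have "measure_pmf.expectation Q f = measure_pmf.expectation \<pi> (\<lambda>(x, y). f y - f x)"
    using coupling_difference[OF fin P Q pi, of f] f by (simp add: centered_lipschitz_def)
  also have "\<dots> = transport_cost d P Q"
    unfolding c by (intro integral_cong_AE) (auto simp: AE_measure_pmf_iff f_def gsupp)
  finally show thesis using f that by blast
qed

section \<open>Relative entropy and exponential tilting\<close>

lemma absolutely_continuous_pmf_iff:
  "absolutely_continuous (measure_pmf P) (measure_pmf Q) \<longleftrightarrow> set_pmf Q \<subseteq> set_pmf P"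
proof
  assume "absolutely_continuous (measure_pmf P) (measure_pmf Q)"
  moreover have "- set_pmf P \<in> null_sets (measure_pmf P)"
    by (simp add: null_sets_def measure_pmf.emeasure_eq_measure measure_pmf_zero_iff)
  ultimately have "- set_pmf P \<in> null_sets (measure_pmf Q)"
    by (auto simp: absolutely_continuous_def)
  then show "set_pmf Q \<subseteq> set_pmf P"
    by (auto simp: null_sets_def measure_pmf.emeasure_eq_measure measure_pmf_zero_iff)
next
  assume "set_pmf Q \<subseteq> set_pmf P"
  then show "absolutely_continuous (measure_pmf P) (measure_pmf Q)"
    by (auto simp: absolutely_continuous_def null_sets_def measure_pmf.emeasure_eq_measure
        measure_pmf_zero_iff)
qed

lemma relative_entropy_finite:
  assumes fin: "finite X" and P: "set_pmf P \<subseteq> X" and QP: "set_pmf Q \<subseteq> set_pmf P"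
  shows "relative_entropy Q P = ereal (\<Sum>x\<in>X. pmf Q x * ln (pmf Q x / pmf P x))"
proof -
  have dens: "measure_pmf Q = density (measure_pmf P) (\<lambda>x. ennreal (pmf Q x / pmf P x))"
  proof -
    have "ennreal (pmf P x) * ennreal (pmf Q x / pmf P x) = ennreal (pmf Q x)" for x
      using QP by (cases "x \<in> set_pmf P") (auto simp: set_pmf_iff ennreal_mult' [symmetric])
    then show ?thesis
      by (simp add: measure_pmf_eq_density density_density_eq)
  qed
  have "KL_divergence (exp 1) (measure_pmf P) (measure_pmf Q)
      = measure_pmf.expectation P (\<lambda>x. pmf Q x / pmf P x * log (exp 1) (pmf Q x / pmf P x))"
    by (subst dens, rule sigma_finite_measure.KL_density[OF
          prob_space_imp_sigma_finite[OF prob_space_measure_pmf]]) auto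
  also have "\<dots> = (\<Sum>x\<in>X. pmf Q x * ln (pmf Q x / pmf P x))"
    unfolding expectation_finite_support[OF fin P]
  proof (intro sum.cong refl)
    fix x
    show "pmf Q x / pmf P x * log (exp 1) (pmf Q x / pmf P x) * pmf P x
        = pmf Q x * ln (pmf Q x / pmf P x)"
      using QP by (cases "x \<in> set_pmf P") (auto simp: set_pmf_iff log_def)
  qed
  finally show ?thesis
    using QP by (simp add: relative_entropy_def absolutely_continuous_pmf_iff)
qed

text \<open>This is nonnegativity of the entropy of \<open>Q\<close> relative to the tilted measure,
  proved pointwise from \<open>ln r \<le> r - 1\<close>. Without absolute continuity the right side
  is infinite.\<close>

lemma donsker_varadhan_le:
  fixes f :: "'a \<Rightarrow> real"
  assumes fin: "finite X" and P: "set_pmf P \<subseteq> X"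
  shows "ereal (measure_pmf.expectation Q f - ln (measure_pmf.expectation P (\<lambda>x. exp (f x))))
    \<le> relative_entropy Q P"
proof (cases "set_pmf Q \<subseteq> set_pmf P")
  case False
  then show ?thesis by (simp add: relative_entropy_def absolutely_continuous_pmf_iff)
next
  case QP: True
  with P have Q: "set_pmf Q \<subseteq> X" by simp
  define Z where "Z = measure_pmf.expectation P (\<lambda>x. exp (f x))"
  have Z: "0 < Z" unfolding Z_def using expectation_exp_pos[OF fin P] .
  have "(f x - ln Z) * pmf Q x - pmf Q x * ln (pmf Q x / pmf P x)
      \<le> exp (f x) * pmf P x / Z - pmf Q x" for x
  proof (cases "x \<in> set_pmf Q")
    case True
    then have pos: "0 < pmf Q x" "0 < pmf P x" using QP by (auto simp: pmf_positive)
    \<comment> \<open>The ratio of the tilted mass to the mass of \<open>Q\<close> at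
      \<open>x\<close>.\<close>
    define r where "r = exp (f x) * pmf P x / (Z * pmf Q x)"
    have "0 < r" using pos Z by (simp add: r_def)
    have "(f x - ln Z) - ln (pmf Q x / pmf P x) = ln r"
      using pos Z by (simp add: r_def ln_div ln_mult)
    then have "(f x - ln Z) * pmf Q x - pmf Q x * ln (pmf Q x / pmf P x) = pmf Q x * ln r"
      by (simp add: algebra_simps)
    also have "\<dots> \<le> pmf Q x * (r - 1)"
      using \<open>0 < r\<close> pos by (intro mult_left_mono ln_le_minus_one) auto
    also have "\<dots> = exp (f x) * pmf P x / Z - pmf Q x"
      using pos Z by (simp add: r_def field_simps)
    finally show ?thesis .
  next
    case False
    then show ?thesis using Z by (simp add: set_pmf_iff)
  qed
  then have "(\<Sum>x\<in>X. (f x - ln Z) * pmf Q x - pmf Q x * ln (pmf Q x / pmf P x))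
      \<le> (\<Sum>x\<in>X. exp (f x) * pmf P x / Z - pmf Q x)"
    by (intro sum_mono)
  \<comment> \<open>The tilted measure and \<open>Q\<close> both have total mass 1.\<close>
  also have "\<dots> = 0"
    using Z sum_pmf_eq_1[OF fin Q] expectation_finite_support[OF fin P, of "\<lambda>x. exp (f x)"]
    by (simp add: sum_subtractf Z_def flip: sum_divide_distrib)
  finally have "measure_pmf.expectation Q f - ln Z \<le> (\<Sum>x\<in>X. pmf Q x * ln (pmf Q x / pmf P x))"
    using sum_pmf_eq_1[OF fin Q] expectation_finite_support[OF fin Q, of f]
    by (simp add: left_diff_distrib sum_subtractf flip: sum_distrib_left)
  then show ?thesis
    using relative_entropy_finite[OF fin P QP] by (simp add: Z_def)
qed

text \<open>The density proportional to \<open>exp (f x)\<close> has logarithm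
  \<open>f x - ln Z\<close> on the support of \<open>P\<close>, which gives equality in the
  Donsker--Varadhan bound.\<close>

lemma obtain_tilted_pmf:
  fixes f :: "'a \<Rightarrow> real"
  assumes fin: "finite X" and P: "set_pmf P \<subseteq> X"
  obtains Q where "set_pmf Q \<subseteq> X"
    "\<And>g. measure_pmf.expectation Q g = measure_pmf.expectation P (\<lambda>x. g x * exp (f x))
          / measure_pmf.expectation P (\<lambda>x. exp (f x))"
    "relative_entropy Q P
      = ereal (measure_pmf.expectation Q f - ln (measure_pmf.expectation P (\<lambda>x. exp (f x))))"
proof -
  define Z where "Z = measure_pmf.expectation P (\<lambda>x. exp (f x))"
  have Z: "0 < Z" unfolding Z_def using expectation_exp_pos[OF fin P] .
  have "(\<Sum>x\<in>X. exp (f x) * pmf P x / Z) = 1"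
    using Z expectation_finite_support[OF fin P, of "\<lambda>x. exp (f x)"]
    by (simp add: Z_def flip: sum_divide_distrib)
  moreover have "x \<notin> X \<Longrightarrow> pmf P x = 0" for x
    using P by (auto simp: set_pmf_iff)
  ultimately obtain Q where q: "pmf Q = (\<lambda>x. exp (f x) * pmf P x / Z)" and Q: "set_pmf Q \<subseteq> X"
    using obtain_pmf[OF fin, of "\<lambda>x. exp (f x) * pmf P x / Z"] Z by auto
  have QP: "set_pmf Q \<subseteq> set_pmf P"
    by (auto simp: set_pmf_iff q)
  have E: "measure_pmf.expectation Q g = measure_pmf.expectation P (\<lambda>x. g x * exp (f x)) / Z" for g
    by (simp add: expectation_finite_support[OF fin P] expectation_finite_support[OF fin Q] q
        sum_divide_distrib mult_ac)
  have "pmf Q x * ln (pmf Q x / pmf P x) = f x * pmf Q x - ln Z * pmf Q x" for x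
  proof (cases "pmf P x = 0")
    case False
    then have "pmf Q x / pmf P x = exp (f x) / Z" by (simp add: q)
    then have "ln (pmf Q x / pmf P x) = f x - ln Z" using Z by (simp add: ln_div)
    then show ?thesis by (simp only: mult.commute[of "pmf Q x"] left_diff_distrib)
  qed (simp add: q)
  then have "relative_entropy Q P = ereal (measure_pmf.expectation Q f - ln Z)"
    using sum_pmf_eq_1[OF fin Q] unfolding relative_entropy_finite[OF fin P QP]
    by (simp add: expectation_finite_support[OF fin Q] sum_subtractf flip: sum_distrib_left)
  with Q E that show thesis unfolding Z_def by blast
qed

section \<open>The convex envelope of the rate function\<close>

lemma log_laplace_upper:
  assumes "finite_metric_prob_space X d P" "f \<in> centered_lipschitz X d P"
  shows "ln (measure_pmf.expectation P (\<lambda>x. exp (l * f x))) \<le> log_laplace X d P l"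
  using log_laplace_attained[OF assms(1), of l] assms(2) by force

text \<open>For each admissible \<open>Q\<close>, a Kantorovich potential \<open>f\<close> converts
  the cost into an expectation under \<open>Q\<close>; Donsker--Varadhan is then applied to
  \<open>l * f\<close>.\<close>

lemma affine_le_phi:
  assumes G: "finite_metric_prob_space X d P" and l: "0 \<le> l"
  shows "ereal (l * s - log_laplace X d P l) \<le> phi X d P s"
  unfolding phi_def
proof (rule INF_greatest)
  fix Q assume "Q \<in> {Q. set_pmf Q \<subseteq> X \<and> transport_cost d P Q > s}"
  then have Q: "set_pmf Q \<subseteq> X" and s: "s < transport_cost d P Q" by auto
  have fin: "finite X" and P: "set_pmf P \<subseteq> X"
    using G by (auto simp: finite_metric_prob_space_def)
  obtain f where f: "f \<in> centered_lipschitz X d P"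
    and c: "measure_pmf.expectation Q f = transport_cost d P Q"
    using kantorovich_potential[OF G Q] .
  have "l * s \<le> measure_pmf.expectation Q (\<lambda>x. l * f x)"
    using s l by (simp add: c mult_left_mono)
  then have "ereal (l * s - log_laplace X d P l)
      \<le> ereal (measure_pmf.expectation Q (\<lambda>x. l * f x)
          - ln (measure_pmf.expectation P (\<lambda>x. exp (l * f x))))"
    using log_laplace_upper[OF G f, of l] by simp
  also have "\<dots> \<le> relative_entropy Q P"
    by (rule donsker_varadhan_le[OF fin P])
  finally show "ereal (l * s - log_laplace X d P l) \<le> relative_entropy Q P" .
qed

lemma rate_le_envelope:
  assumes G: "finite_metric_prob_space X d P"
  shows "rate X d P \<tau> \<le> lower_convex_envelope (phi X d P) \<tau>"
  unfolding rate_def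
proof (rule SUP_least)
  fix l :: real assume "l \<in> {0..}"
  then have "0 \<le> l" by simp
  have "convex_on {0..} (\<lambda>s. l * s - log_laplace X d P l)"
    by (intro convex_onI) (auto simp: algebra_simps)
  with affine_le_phi[OF G \<open>0 \<le> l\<close>]
  show "ereal (l * \<tau> - log_laplace X d P l) \<le> lower_convex_envelope (phi X d P) \<tau>"
    unfolding lower_convex_envelope_def
    by (intro SUP_upper2[of "\<lambda>s. l * s - log_laplace X d P l"]) auto
qed

section \<open>Tilted measures as test points for \<open>phi\<close>\<close>

lemma expectation_exp_centered_ge_1:
  fixes f :: "'a \<Rightarrow> real"
  assumes "finite X" "set_pmf P \<subseteq> X" "measure_pmf.expectation P f = 0"
  shows "1 \<le> measure_pmf.expectation P (\<lambda>x. exp (a * f x))"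
proof -
  have "(\<Sum>x\<in>X. (1 + a * f x) * pmf P x) \<le> (\<Sum>x\<in>X. exp (a * f x) * pmf P x)"
    by (intro sum_mono mult_right_mono) auto
  moreover have "(\<Sum>x\<in>X. (1 + a * f x) * pmf P x) = 1"
    using assms(3) sum_pmf_eq_1[OF assms(1,2)]
    by (simp add: expectation_finite_support[OF assms(1,2)] distrib_right sum.distrib mult.assoc
        flip: sum_distrib_left)
  ultimately show ?thesis
    by (simp add: expectation_finite_support[OF assms(1,2)])
qed

text \<open>Subtracting the zero mean of \<open>f\<close> leaves the integrand
  \<open>t * (exp (a * t) - 1)\<close> at \<open>t = f x\<close>, which is positive unless
  \<open>t = 0\<close>.\<close>

lemma tilted_mean_pos:
  fixes f :: "'a \<Rightarrow> real"
  assumes fin: "finite X" and P: "set_pmf P \<subseteq> X" and f: "measure_pmf.expectation P f = 0"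
    and x: "x \<in> set_pmf P" "f x \<noteq> 0" and a: "0 < a"
  shows "0 < measure_pmf.expectation P (\<lambda>x. f x * exp (a * f x))"
proof -
  have pos: "0 < t * (exp (a * t) - 1)" if "t \<noteq> 0" for t
  proof (cases "0 < t")
    case False
    with that a have "a * t < 0" by (simp add: mult_pos_neg)
    with that False show ?thesis by (intro mult_neg_neg) auto
  qed (use a in simp)
  have nonneg: "0 \<le> t * (exp (a * t) - 1)" for t
    using pos[of t] by (cases "t = 0") auto
  have "0 < (\<Sum>x\<in>X. f x * (exp (a * f x) - 1) * pmf P x)"
  proof (rule sum_pos2[OF fin])
    show "x \<in> X" using x P by auto
    show "0 < f x * (exp (a * f x) - 1) * pmf P x"
      using pos[OF x(2)] pmf_positive[OF x(1)] by (rule mult_pos_pos)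
    show "0 \<le> f y * (exp (a * f y) - 1) * pmf P y" for y
      by (rule mult_nonneg_nonneg[OF nonneg pmf_nonneg])
  qed
  also have "\<dots> = measure_pmf.expectation P (\<lambda>x. f x * exp (a * f x)) - measure_pmf.expectation P f"
    by (simp add: expectation_finite_support[OF fin P] algebra_simps sum_subtractf)
  finally show ?thesis using f by simp
qed

text \<open>Here \<open>m\<close> is the mean of \<open>f\<close> under the measure tilted by
  \<open>a * f\<close>. It bounds the transport cost from below, so this measure is admissible for
  all \<open>s < m\<close>. The upper bound on \<open>m\<close> is uniform in \<open>a\<close>, as
  needed for small tilts.\<close>

lemma phi_le_tilted:
  assumes G: "finite_metric_prob_space X d P"
    and f: "f \<in> centered_lipschitz X d P" and x: "x \<in> set_pmf P" "f x \<noteq> 0" and a: "0 < a"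
  obtains m where "0 < m" "m \<le> (\<Sum>x\<in>X. \<bar>f x\<bar>)"
    "\<And>s. s < m \<Longrightarrow> phi X d P s \<le> ereal (a * m - ln (measure_pmf.expectation P (\<lambda>x. exp (a * f x))))"
proof -
  have fin: "finite X" and P: "set_pmf P \<subseteq> X"
    using G by (auto simp: finite_metric_prob_space_def)
  have f0: "measure_pmf.expectation P f = 0" using f by (simp add: centered_lipschitz_def)
  obtain Q where Q: "set_pmf Q \<subseteq> X"
    and E: "\<And>g. measure_pmf.expectation Q g = measure_pmf.expectation P (\<lambda>x. g x * exp (a * f x))
          / measure_pmf.expectation P (\<lambda>x. exp (a * f x))"
    and D: "relative_entropy Q P = ereal (measure_pmf.expectation Q (\<lambda>x. a * f x)
          - ln (measure_pmf.expectation P (\<lambda>x. exp (a * f x))))"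
    using obtain_tilted_pmf[OF fin P, of "\<lambda>x. a * f x"] by metis
  show thesis
  proof
    show "0 < measure_pmf.expectation Q f"
      unfolding E using tilted_mean_pos[OF fin P f0 x a] expectation_exp_pos[OF fin P]
      by (intro divide_pos_pos)
    show "measure_pmf.expectation Q f \<le> (\<Sum>x\<in>X. \<bar>f x\<bar>)"
      unfolding expectation_finite_support[OF fin Q]
    proof (rule sum_mono)
      fix x
      have "f x * pmf Q x \<le> \<bar>f x\<bar> * pmf Q x" by (intro mult_right_mono) auto
      also have "\<dots> \<le> \<bar>f x\<bar> * 1" by (intro mult_left_mono pmf_le_1) auto
      finally show "f x * pmf Q x \<le> \<bar>f x\<bar>" by simp
    qed
    fix s assume "s < measure_pmf.expectation Q f"
    then have "s < transport_cost d P Q"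
      using transport_cost_ge_lipschitz[OF G Q f] by simp
    then have "phi X d P s \<le> relative_entropy Q P"
      unfolding phi_def using Q by (intro INF_lower) auto
    then show "phi X d P s \<le> ereal (a * measure_pmf.expectation Q f
        - ln (measure_pmf.expectation P (\<lambda>x. exp (a * f x))))"
      by (simp add: D)
  qed
qed

text \<open>Tilting with \<open>a = e / S\<close> has entropy at most \<open>a * m \<le> e\<close>,
  since the log-Laplace term is nonnegative; the positive mean makes the tilted measure admissible
  at 0.\<close>

lemma phi_0_nonpos:
  assumes G: "finite_metric_prob_space X d P"
    and f: "f \<in> centered_lipschitz X d P" and x: "x \<in> set_pmf P" "f x \<noteq> 0"
  shows "phi X d P 0 \<le> 0"
proof (rule ereal_le_epsilon2)
  fix e :: real
  assume e: "0 < e"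
  have fin: "finite X" and P: "set_pmf P \<subseteq> X"
    using G by (auto simp: finite_metric_prob_space_def)
  define S where "S = (\<Sum>x\<in>X. \<bar>f x\<bar>)"
  have "\<bar>f x\<bar> \<le> S" unfolding S_def using x P fin by (intro member_le_sum) auto
  then have S: "0 < S" using x by simp
  obtain m where m: "0 < m" "m \<le> S" and
    phi: "phi X d P 0 \<le> ereal (e / S * m - ln (measure_pmf.expectation P (\<lambda>x. exp (e / S * f x))))"
    using phi_le_tilted[OF G f x, of "e / S"] e S unfolding S_def by (metis divide_pos_pos)
  have "1 \<le> measure_pmf.expectation P (\<lambda>x. exp (e / S * f x))"
    using f by (intro expectation_exp_centered_ge_1[OF fin P]) (simp add: centered_lipschitz_def)
  then have "0 \<le> ln (measure_pmf.expectation P (\<lambda>x. exp (e / S * f x)))" by simp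
  moreover have "e / S * m \<le> e" using e m S by (simp add: field_simps)
  ultimately have "ereal (e / S * m - ln (measure_pmf.expectation P (\<lambda>x. exp (e / S * f x)))) \<le> ereal e"
    by simp
  with phi have "phi X d P 0 \<le> ereal e" by (rule order_trans)
  then show "phi X d P 0 \<le> 0 + ereal e" by simp
qed

text \<open>Comparing the line with the tilted bound as \<open>s\<close> increases to
  \<open>m\<close> cancels \<open>a * m\<close> and leaves \<open>L \<le> b\<close>. The function
  \<open>f\<close> guarantees \<open>b \<ge> 0\<close>, which covers a maximizer vanishing on the
  support of \<open>P\<close>.\<close>

lemma log_laplace_le_intercept:
  assumes G: "finite_metric_prob_space X d P"
    and f: "f \<in> centered_lipschitz X d P" and x: "x \<in> set_pmf P" "f x \<noteq> 0" and a: "0 < a"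
    and minorant: "\<And>s. 0 \<le> s \<Longrightarrow> ereal (a * s - b) \<le> phi X d P s"
  shows "log_laplace X d P a \<le> b"
proof -
  have fin: "finite X" and P: "set_pmf P \<subseteq> X"
    using G by (auto simp: finite_metric_prob_space_def)
  have bound: "ln (measure_pmf.expectation P (\<lambda>x. exp (a * g x))) \<le> b"
    if g: "g \<in> centered_lipschitz X d P" and y: "y \<in> set_pmf P" "g y \<noteq> 0" for g y
  proof (rule ccontr)
    define L where "L = ln (measure_pmf.expectation P (\<lambda>x. exp (a * g x)))"
    assume "\<not> ?thesis"
    then have L: "b < L" by (simp add: L_def)
    obtain m where m: "0 < m" and phi: "\<And>s. s < m \<Longrightarrow> phi X d P s \<le> ereal (a * m - L)"
      using phi_le_tilted[OF G g y a] unfolding L_def by metis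
    \<comment> \<open>Close enough to \<open>m\<close> that the line loses at most half of the gap
      \<open>L - b\<close>; the maximum with 0 stays in the domain of the minorant.\<close>
    define s where "s = max 0 (m - (L - b) / (2 * a))"
    have "0 < (L - b) / (2 * a)" using L a by simp
    then have s: "0 \<le> s" "s < m" using m by (auto simp: s_def)
    have "ereal (a * s - b) \<le> ereal (a * m - L)"
      using minorant[OF s(1)] phi[OF s(2)] by (rule order_trans)
    then have "L - b \<le> a * (m - s)" by (simp add: algebra_simps)
    also have "\<dots> \<le> a * ((L - b) / (2 * a))"
      using a by (intro mult_left_mono) (auto simp: s_def)
    also have "\<dots> < L - b" using L a by simp
    finally show False by simp
  qed
  have "0 \<le> b"
  proof -
    have "1 \<le> measure_pmf.expectation P (\<lambda>x. exp (a * f x))"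
      using f by (intro expectation_exp_centered_ge_1[OF fin P]) (simp add: centered_lipschitz_def)
    then have "0 \<le> ln (measure_pmf.expectation P (\<lambda>x. exp (a * f x)))" by simp
    with bound[OF f x] show ?thesis by simp
  qed
  obtain g where g: "g \<in> centered_lipschitz X d P"
    and L: "log_laplace X d P a = ln (measure_pmf.expectation P (\<lambda>x. exp (a * g x)))"
    using log_laplace_attained[OF G, of a] by blast
  show ?thesis
  proof (cases "\<exists>y\<in>set_pmf P. g y \<noteq> 0")
    case True
    then show ?thesis using bound[OF g] L by auto
  next
    case False
    then have "measure_pmf.expectation P (\<lambda>x. exp (a * g x)) = measure_pmf.expectation P (\<lambda>x. 1)"
      by (intro integral_cong_AE) (auto simp: AE_measure_pmf_iff)
    with \<open>0 \<le> b\<close> show ?thesis by (simp add: L)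
  qed
qed

section \<open>Convex minorants and the rate\<close>

lemma log_laplace_0: "finite_metric_prob_space X d P \<Longrightarrow> log_laplace X d P 0 = 0"
  using log_laplace_attained[of X d P 0] by auto

lemma rate_nonneg:
  assumes "finite_metric_prob_space X d P"
  shows "0 \<le> rate X d P \<tau>"
  unfolding rate_def
  by (rule SUP_upper2[of 0]) (auto simp: log_laplace_0[OF assms])

text \<open>This degenerate case occurs for a point mass. The log-Laplace term vanishes identically,
  so \<open>l * \<tau>\<close> is unbounded in \<open>l\<close>.\<close>

lemma rate_trivial:
  assumes G: "finite_metric_prob_space X d P" and \<tau>: "0 < \<tau>"
    and triv: "\<And>f x. f \<in> centered_lipschitz X d P \<Longrightarrow> x \<in> set_pmf P \<Longrightarrow> f x = 0"
  shows "rate X d P \<tau> = \<infinity>"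
proof -
  have L: "log_laplace X d P l = 0" for l
  proof -
    obtain g where g: "g \<in> centered_lipschitz X d P"
      and L: "log_laplace X d P l = ln (measure_pmf.expectation P (\<lambda>x. exp (l * g x)))"
      using log_laplace_attained[OF G, of l] by blast
    have "measure_pmf.expectation P (\<lambda>x. exp (l * g x)) = measure_pmf.expectation P (\<lambda>x. 1)"
      using triv[OF g] by (intro integral_cong_AE) (auto simp: AE_measure_pmf_iff)
    then show ?thesis by (simp add: L)
  qed
  have "\<exists>l\<in>{0..}. ereal (real n) \<le> ereal (l * \<tau> - log_laplace X d P l)" for n
    using \<tau> by (intro bexI[of _ "real n / \<tau>"]) (auto simp: L)
  then show ?thesis
    unfolding rate_def by (intro SUP_PInfty)
qed

lemma convex_minorant_le_rate:
  assumes G: "finite_metric_prob_space X d P" and \<tau>: "0 < \<tau>"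
    and h: "convex_on {0..} h" and le: "\<And>s. 0 \<le> s \<Longrightarrow> ereal (h s) \<le> phi X d P s"
  shows "ereal (h \<tau>) \<le> rate X d P \<tau>"
proof (cases "\<exists>f\<in>centered_lipschitz X d P. \<exists>x\<in>set_pmf P. f x \<noteq> 0")
  case False
  then show ?thesis using rate_trivial[OF G \<tau>] by auto
next
  case True
  then obtain f x where f: "f \<in> centered_lipschitz X d P" and x: "x \<in> set_pmf P" "f x \<noteq> 0"
    by blast
  \<comment> \<open>The right derivative of \<open>h\<close> at \<open>\<tau>\<close>, which is a
    subgradient because \<open>\<tau> > 0\<close> is interior to the domain.\<close>
  define a where "a = Inf ((\<lambda>t. (h \<tau> - h t) / (\<tau> - t)) ` ({\<tau><..} \<inter> {0..}))"
  have sub: "h \<tau> + a * (s - \<tau>) \<le> h s" if "0 \<le> s" for s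
    unfolding a_def using that \<tau> by (intro convex_le_Inf_differential[OF h]) auto
  show ?thesis
  proof (cases "0 < a")
    case True
    have "ereal (a * s - (a * \<tau> - h \<tau>)) \<le> phi X d P s" if "0 \<le> s" for s
    proof -
      have "ereal (a * s - (a * \<tau> - h \<tau>)) \<le> ereal (h s)"
        using sub[OF that] by (simp add: algebra_simps)
      with le[OF that] show ?thesis by (rule order_trans[rotated])
    qed
    then have "log_laplace X d P a \<le> a * \<tau> - h \<tau>"
      by (rule log_laplace_le_intercept[OF G f x True])
    then have "ereal (h \<tau>) \<le> ereal (a * \<tau> - log_laplace X d P a)" by simp
    with True show ?thesis
      unfolding rate_def by (intro SUP_upper2[of a]) auto
  next
    case False
    then have "0 \<le> a * (0 - \<tau>)" using \<tau> by (simp add: mult_le_0_iff)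
    with sub[of 0] have "h \<tau> \<le> h 0" by simp
    then have "ereal (h \<tau>) \<le> ereal (h 0)" by simp
    also have "\<dots> \<le> phi X d P 0" by (rule le) simp
    also have "\<dots> \<le> 0" by (rule phi_0_nonpos[OF G f x])
    also have "\<dots> \<le> rate X d P \<tau>" by (rule rate_nonneg[OF G])
    finally show ?thesis .
  qed
qed

theorem theorem7:
  fixes X :: "'a set" and d :: "'a \<Rightarrow> 'a \<Rightarrow> real" and P :: "'a pmf" and \<tau> :: real
  assumes "finite_metric_prob_space X d P" and "\<tau> > 0"
  shows "lower_convex_envelope (phi X d P) \<tau> = rate X d P \<tau>"
proof (rule antisym)
  show "lower_convex_envelope (phi X d P) \<tau> \<le> rate X d P \<tau>"
    unfolding lower_convex_envelope_def
    using convex_minorant_le_rate[OF assms] by (intro SUP_least) auto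
  show "rate X d P \<tau> \<le> lower_convex_envelope (phi X d P) \<tau>"
    by (rule rate_le_envelope[OF assms(1)])
qed

end
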